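(* With $\delta(c)$ as defined in the context, \[ \delta(4)=\tfrac12(\sqrt{13}+5),\qquad \delta(5)=\tfrac12(\sqrt{24}+6),\qquad \delta(6)=\tfrac12(\sqrt{37}+7). \]
   Context: For integers $\ell,c\ge 1$ let $W(\ell,c)$ be the set of sequences $\alpha=(\alpha_1,\dots,\alpha_d)$ of length $d=\ell+c-2$ with entries in $\{1,2\}$ having exactly $\ell-1$ entries equal to $1$ and $c-1$ entries equal to $2$. For $0\le i\le d$ and $s\in\{1,2\}$ let $\nu_{i,s}:=1+|\{1\le j\le i:\alpha_j=s\}|$. Define integers recursively: $x_{1,0}:=x_{2,0}:=0$, and for $i=0,1,\dots,d$ in turn let $k_i:=1+\sum_{s\in\{1,2\}}\min_{j_1,j_2\ge 0,\ j_1+j_2=\nu_{i,s}-1}(x_{s,j_1}+x_{s,j_2})$, and, if $i<d$, set $x_{s,\nu_{i,s}}:=k_i$ for $s=\alpha_{i+1}$ (all values used are defined at that time). This defines $x_{1,0},\dots,x_{1,\ell-1}$ and $x_{2,0},\dots,x_{2,c-1}$. Put $\beta(\alpha):=1+\min_{j_1,j_2\ge0,\ j_1+j_2=c-1}(x_{2,j_1}+x_{2,j_2})$ and $\delta(\alpha):=\min_{0\le j\le \ell-1}\frac{x_{1,j}+\beta(\alpha)}{j+1}$. Finally $\delta(1):=1$ and, for $c\ge 2$, $\delta(c):=\sup\{\delta(\alpha): \ell\ge 1,\ \alpha\in W(\ell,c),\ \alpha_{\ell+c-2}=2\}$. *)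

theory Defs
  imports Complex_Main "HOL-Library.Extended_Real"
begin

(* Sequences are lists; the 1-based entry alpha_j is \<alpha> ! (j - 1). *)

definition W :: "nat \<Rightarrow> nat \<Rightarrow> nat list set" where
  "W l c = {\<alpha>. length \<alpha> = l + c - 2 \<and> set \<alpha> \<subseteq> {1, 2} \<and>
              count_list \<alpha> 1 = l - 1 \<and> count_list \<alpha> 2 = c - 1}"

definition nu :: "nat list \<Rightarrow> nat \<Rightarrow> nat \<Rightarrow> nat" where
  "nu \<alpha> i s = 1 + card {j. 1 \<le> j \<and> j \<le> i \<and> \<alpha> ! (j - 1) = s}"

definition min_conv :: "(nat \<Rightarrow> int) \<Rightarrow> nat \<Rightarrow> int" where
  "min_conv f n = Min {f j1 + f j2 | j1 j2. j1 + j2 = n}"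

definition k_val :: "nat list \<Rightarrow> (nat \<Rightarrow> nat \<Rightarrow> int) \<Rightarrow> nat \<Rightarrow> int" where
  "k_val \<alpha> x i = 1 + (\<Sum>s\<in>{1, 2}. min_conv (x s) (nu \<alpha> i s - 1))"

(* x_upto \<alpha> i s j is x_{s,j} as known before stage i, i.e. for j < nu \<alpha> i s.
   The value 0 at any other index is a placeholder that is never read. *)
primrec x_upto :: "nat list \<Rightarrow> nat \<Rightarrow> nat \<Rightarrow> nat \<Rightarrow> int" where
  "x_upto \<alpha> 0 = (\<lambda>s j. 0)"
| "x_upto \<alpha> (Suc i) =
     (\<lambda>s j. if s = \<alpha> ! i \<and> j = nu \<alpha> i s then k_val \<alpha> (x_upto \<alpha> i) i else x_upto \<alpha> i s j)"

definition x_val :: "nat list \<Rightarrow> nat \<Rightarrow> nat \<Rightarrow> int" where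
  "x_val \<alpha> = x_upto \<alpha> (length \<alpha>)"

definition beta :: "nat \<Rightarrow> nat list \<Rightarrow> int" where
  "beta c \<alpha> = 1 + min_conv (x_val \<alpha> 2) (c - 1)"

definition delta_seq :: "nat \<Rightarrow> nat \<Rightarrow> nat list \<Rightarrow> real" where
  "delta_seq l c \<alpha> =
     Min ((\<lambda>j. real_of_int (x_val \<alpha> 1 j + beta c \<alpha>) / real (j + 1)) ` {0..l - 1})"

(* The supremum is taken in the extended reals, so that an equation with a real number
   also asserts that the set is bounded above. *)
definition delta :: "nat \<Rightarrow> ereal" where
  "delta c = (if c = 1 then 1
     else Sup {ereal (delta_seq l c \<alpha>) | l \<alpha>. l \<ge> 1 \<and> \<alpha> \<in> W l c \<and> \<alpha> ! (l + c - 2 - 1) = 2})"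

end

theory Submission imports Defs begin

text \<open>Put \<open>X m = x\<^bsub>1,m-1\<^esub> + 1\<close> and let \<open>p\<^sub>i\<close> be one plus the number of ones before the
  \<open>i\<close>-th two. Let \<open>G\<^sub>t\<close> be the minimum of \<open>x\<^bsub>2,i\<^esub> + x\<^bsub>2,t-i\<^esub>\<close>. The shift by one removes the
  additive constants: \<open>X m = G\<^sub>t + min {X a + X b | a + b = m}\<close> when \<open>t\<close> twos precede, that is, for
  \<open>p\<^sub>t < m \<le> p\<^bsub>t+1\<^esub>\<close>, and \<open>\<delta>(\<alpha>)\<close> is the minimum of \<open>(X m + G\<^bsub>c-1\<^esub>) / m\<close>.
  With \<open>H\<^sub>i = min {X a + X b | a + b = p\<^sub>i + 1} - 1\<close> the offset \<open>G\<^bsub>c-1\<^esub>\<close> is at most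
  \<open>2p\<^sub>1 + H\<^sub>2\<close> for \<open>c = 4\<close>, at most both \<open>3p\<^sub>1 + H\<^sub>3\<close> and \<open>2p\<^sub>1 + 2H\<^sub>2\<close> for \<open>c = 5\<close>, and at most
  \<open>3p\<^sub>1 + H\<^sub>2 + H\<^sub>3\<close> for \<open>c = 6\<close>. Splitting into pieces whose lengths are multiples of \<open>p\<^sub>1\<close> bounds
  \<open>X\<close> and \<open>H\<close>, and evaluating the minimum at \<open>p\<^sub>2\<close>, \<open>p\<^sub>3\<close> and suitable multiples of \<open>p\<^sub>1\<close> gives the
  upper bounds. They are approached when \<open>p\<^sub>1 : p\<^sub>2 : p\<^sub>3\<close> tends to \<open>1 : 1 + 1/z : 1 + 2/z\<close> with
  \<open>z = \<delta>(c) - 1\<close> and no ones follow the third two.\<close>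

subsection \<open>The recursion\<close>

lemma nu_0 [simp]: "nu \<alpha> 0 s = 1"
  by (simp add: nu_def)

lemma nu_Suc: "nu \<alpha> (Suc i) s = nu \<alpha> i s + (if \<alpha> ! i = s then 1 else 0)"
proof -
  let ?A = "{j. 1 \<le> j \<and> j \<le> i \<and> \<alpha> ! (j - 1) = s}"
  have "{j. 1 \<le> j \<and> j \<le> Suc i \<and> \<alpha> ! (j - 1) = s} = (if \<alpha> ! i = s then insert (Suc i) ?A else ?A)"
    by (auto simp: le_Suc_eq)
  moreover have "finite ?A"
    by (rule finite_subset[of _ "{..i}"]) auto
  ultimately show ?thesis
    by (simp add: nu_def)
qed

lemma nu_mono: "i \<le> i' \<Longrightarrow> nu \<alpha> i s \<le> nu \<alpha> i' s"
  by (induction i' rule: dec_induct) (auto simp: nu_Suc)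

lemma nu_ge_1: "nu \<alpha> i s \<ge> 1"
  using nu_mono[of 0 i \<alpha> s] by simp

lemma nu_less: "i < i' \<Longrightarrow> \<alpha> ! i = s \<Longrightarrow> nu \<alpha> i s < nu \<alpha> i' s"
  using nu_mono[of "Suc i" i' \<alpha> s] by (simp add: nu_Suc)

lemma nu_eq_count: "i \<le> length \<alpha> \<Longrightarrow> nu \<alpha> i s = 1 + count_list (take i \<alpha>) s"
  by (induction i) (auto simp: nu_Suc take_Suc_conv_app_nth)

lemma nu_length: "nu \<alpha> (length \<alpha>) s = 1 + count_list \<alpha> s"
  by (simp add: nu_eq_count)

text \<open>The counter \<open>nu \<alpha> i s\<close> rises by at most one per step. If
  \<open>Suc q\<close> is the first index where it exceeds \<open>j\<close>, then entry
  \<open>q\<close> is the \<open>j\<close>-th \<open>s\<close>.\<close>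

lemma ex_position:
  assumes "1 \<le> j" "j \<le> count_list \<alpha> s"
  obtains q where "q < length \<alpha>" "\<alpha> ! q = s" "nu \<alpha> q s = j"
proof -
  define r where "r = (LEAST i. j < nu \<alpha> i s)"
  have ex: "j < nu \<alpha> (length \<alpha>) s"
    using assms by (simp add: nu_length)
  have r: "j < nu \<alpha> r s" "r \<le> length \<alpha>"
    unfolding r_def using ex by (auto intro: LeastI Least_le)
  obtain q where q: "r = Suc q"
    using r(1) assms(1) by (cases r) auto
  have "\<not> j < nu \<alpha> q s"
    using q not_less_Least[of q "\<lambda>i. j < nu \<alpha> i s"] unfolding r_def by simp
  then show thesis
    using that[of q] r q by (auto simp: nu_Suc split: if_splits)
qed

section \<open>Minima over all splits of an index\<close>

lemma min_conv_eq: "min_conv f n = Min ((\<lambda>j. f j + f (n - j)) ` {..n})"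
proof -
  have "{f j1 + f j2 | j1 j2. j1 + j2 = n} = (\<lambda>j. f j + f (n - j)) ` {..n}"
    by (auto simp: image_iff) (metis add_diff_cancel_left' atMost_iff le_add1, metis le_add_diff_inverse)
  then show ?thesis
    by (simp add: min_conv_def)
qed

lemma min_conv_le: "a + b = n \<Longrightarrow> min_conv f n \<le> f a + f b"
  unfolding min_conv_eq by (intro Min_le) (auto intro!: image_eqI[of _ _ a])

lemma min_conv_ge: "(\<And>a b. a + b = n \<Longrightarrow> z \<le> f a + f b) \<Longrightarrow> z \<le> min_conv f n"
  unfolding min_conv_eq by (subst Min_ge_iff) auto

lemma min_conv_cong: "(\<And>j. j \<le> n \<Longrightarrow> f j = g j) \<Longrightarrow> min_conv f n = min_conv g n"
  unfolding min_conv_eq by (intro arg_cong[where f = Min] image_cong) auto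

text \<open>A later stage \<open>i'\<close> writes row \<open>s\<close> only at index
  \<open>nu \<alpha> i' s\<close>; by monotonicity of \<open>nu\<close> this lies beyond every index
  filled before, so nothing is overwritten.\<close>

lemma x_upto_stable:
  assumes "i \<le> i'" "j < nu \<alpha> i s"
  shows "x_upto \<alpha> i' s j = x_upto \<alpha> i s j"
  using assms
proof (induction i' rule: dec_induct)
  case (step i')
  have "j < nu \<alpha> i' s"
    using step nu_mono[of i i' \<alpha> s] by simp
  with step show ?case by auto
qed simp

lemma x_val_eq: "i \<le> length \<alpha> \<Longrightarrow> j < nu \<alpha> i s \<Longrightarrow> x_val \<alpha> s j = x_upto \<alpha> i s j"
  unfolding x_val_def by (rule x_upto_stable)

lemma x_val_0 [simp]: "x_val \<alpha> s 0 = 0"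
  using x_val_eq[of 0 \<alpha> 0 s] by simp

text \<open>The two minima read at stage \<open>q\<close> involve only indices below
  \<open>nu \<alpha> q 1\<close> and \<open>nu \<alpha> q 2\<close>, where the values are final.
  Hence the recursion holds for \<open>x_val\<close> itself.\<close>

lemma x_val_rec:
  assumes q: "q < length \<alpha>" and s: "\<alpha> ! q = s"
  shows "x_val \<alpha> s (nu \<alpha> q s) =
    1 + min_conv (x_val \<alpha> 1) (nu \<alpha> q 1 - 1) + min_conv (x_val \<alpha> 2) (nu \<alpha> q 2 - 1)"
proof -
  have eq: "min_conv (x_upto \<alpha> q s') (nu \<alpha> q s' - 1) = min_conv (x_val \<alpha> s') (nu \<alpha> q s' - 1)" for s'
  proof (rule min_conv_cong)
    fix j assume "j \<le> nu \<alpha> q s' - 1"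
    with nu_ge_1[of \<alpha> q s'] have "j < nu \<alpha> q s'" by linarith
    with q show "x_upto \<alpha> q s' j = x_val \<alpha> s' j"
      by (intro x_val_eq[symmetric]) auto
  qed
  have "x_val \<alpha> s (nu \<alpha> q s) = x_upto \<alpha> (Suc q) s (nu \<alpha> q s)"
    using q s by (intro x_val_eq) (auto simp: nu_Suc)
  also have "\<dots> = k_val \<alpha> (x_upto \<alpha> q) q"
    using s by simp
  finally show ?thesis
    using eq[of 1] eq[of 2] by (simp add: k_val_def)
qed

lemma x_upto_nonneg: "0 \<le> x_upto \<alpha> i s j"
proof (induction i arbitrary: s j)
  case (Suc i)
  have "0 \<le> min_conv (x_upto \<alpha> i s') n" for s' n
    using Suc by (intro min_conv_ge) simp
  then have "0 \<le> k_val \<alpha> (x_upto \<alpha> i) i"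
    by (simp add: k_val_def)
  with Suc show ?case by simp
qed simp

lemma x_val_nonneg: "0 \<le> x_val \<alpha> s j"
  by (simp add: x_val_def x_upto_nonneg)

lemma min_conv_x_val_nonneg: "0 \<le> min_conv (x_val \<alpha> s) n"
  by (intro min_conv_ge add_nonneg_nonneg x_val_nonneg)

text \<open>Here \<open>t\<close> is the number of twos before the \<open>j\<close>-th one. The
  equivalence records this without naming the position: a two is among the first \<open>t\<close>
  exactly when fewer than \<open>j\<close> ones precede it.\<close>

lemma x_val_1_rec:
  assumes j: "1 \<le> j" "j \<le> count_list \<alpha> 1"
  obtains t where
    "x_val \<alpha> 1 j = 1 + min_conv (x_val \<alpha> 1) (j - 1) + min_conv (x_val \<alpha> 2) t"
    "\<And>q. \<alpha> ! q = 2 \<Longrightarrow> nu \<alpha> q 2 \<le> t \<longleftrightarrow> nu \<alpha> q 1 \<le> j"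
proof -
  obtain r where r: "r < length \<alpha>" "\<alpha> ! r = 1" "nu \<alpha> r 1 = j"
    using ex_position[OF j] .
  have iff: "nu \<alpha> q 2 \<le> nu \<alpha> r 2 - 1 \<longleftrightarrow> nu \<alpha> q 1 \<le> j" if "\<alpha> ! q = 2" for q
  proof (cases "q < r")
    case True
    then show ?thesis
      using nu_less[OF True that] nu_mono[of q r \<alpha> 1] r by simp
  next
    case False
    with that r have "r < q" by (cases "r = q") auto
    then show ?thesis
      using nu_less[OF \<open>r < q\<close> r(2)] nu_mono[of r q \<alpha> 2] nu_ge_1[of \<alpha> r 2] r by simp
  qed
  show thesis
    using that[OF _ iff] x_val_rec[OF r(1,2)] r(3) by simp
qed

text \<open>Each step adds \<open>1\<close> to a sum of two entries whose indices add up to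
  \<open>j - 1\<close>, and the twos contribute a nonnegative amount. In the lower bounds on
  \<open>delta\<close> this linear bound replaces the minima over row one.\<close>

lemma x_val_1_ge: "j \<le> count_list \<alpha> 1 \<Longrightarrow> int j \<le> x_val \<alpha> 1 j"
proof (induction j rule: less_induct)
  case (less j)
  show ?case
  proof (cases "j = 0")
    case False
    then obtain t where t: "x_val \<alpha> 1 j = 1 + min_conv (x_val \<alpha> 1) (j - 1) + min_conv (x_val \<alpha> 2) t"
      using x_val_1_rec[of j \<alpha>] less.prems by auto
    have "int (j - 1) \<le> min_conv (x_val \<alpha> 1) (j - 1)"
    proof (rule min_conv_ge)
      fix a b assume "a + b = j - 1"
      with False less have "int a \<le> x_val \<alpha> 1 a" "int b \<le> x_val \<alpha> 1 b" by auto
      with \<open>a + b = j - 1\<close> show "int (j - 1) \<le> x_val \<alpha> 1 a + x_val \<alpha> 1 b" by linarith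
    qed
    with t False min_conv_x_val_nonneg[of \<alpha> 2 t] show ?thesis by auto
  qed simp
qed

lemma min_conv_x_val_1_ge:
  assumes "n \<le> count_list \<alpha> 1"
  shows "int n \<le> min_conv (x_val \<alpha> 1) n"
proof (rule min_conv_ge)
  fix a b assume "a + b = n"
  with assms x_val_1_ge[of a \<alpha>] x_val_1_ge[of b \<alpha>]
  show "int n \<le> x_val \<alpha> 1 a + x_val \<alpha> 1 b" by linarith
qed

lemma nu_append_Cons: "nu (us @ v # vs) (length us) s = 1 + count_list us s"
  by (simp add: nu_eq_count)

text \<open>Splitting the list at a two exposes the two counts that its recursion reads. The minimum
  over row one is estimated linearly, which leaves a recursion for row two alone.\<close>

lemma x_val_2_ge:
  assumes "\<alpha> = us @ 2 # vs"
  shows "1 + int (count_list us 1) + min_conv (x_val \<alpha> 2) (count_list us 2)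
    \<le> x_val \<alpha> 2 (Suc (count_list us 2))"
proof -
  have "nu \<alpha> (length us) s = 1 + count_list us s" for s
    using assms by (simp add: nu_append_Cons)
  moreover have "\<alpha> ! length us = 2" "length us < length \<alpha>"
    using assms by auto
  moreover have "count_list us 1 \<le> count_list \<alpha> 1"
    using assms by simp
  ultimately show ?thesis
    using x_val_rec[of "length us" \<alpha> 2] min_conv_x_val_1_ge[of "count_list us 1" \<alpha>] by simp
qed

text \<open>The minimum is at most its term at index \<open>m - 1\<close>; multiplying out by
  \<open>m\<close> makes the bound linear in the entries.\<close>

lemma delta_seq_le:
  assumes "1 \<le> m" "m \<le> l"
  shows "delta_seq l c \<alpha> * m \<le> x_val \<alpha> 1 (m - 1) + 1 + min_conv (x_val \<alpha> 2) (c - 1)"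
proof -
  have "delta_seq l c \<alpha> \<le> real_of_int (x_val \<alpha> 1 (m - 1) + beta c \<alpha>) / real (m - 1 + 1)"
    unfolding delta_seq_def using assms by (intro Min_le imageI) auto
  with assms show ?thesis
    by (simp add: beta_def field_simps)
qed

subsection \<open>Upper bounds\<close>

text \<open>Inequalities for the shifted row \<open>X\<close>: while at most
  \<open>t \<le> 2\<close> twos have occurred, gluing pieces of lengths \<open>a\<close> and
  \<open>b\<close> costs \<open>G\<^sub>t \<le> t * p1\<close>. Each step covers all totals up to
  the end of its phase, because the cost of a later phase also covers the earlier ones.\<close>

locale staircase =
  fixes X :: "nat \<Rightarrow> real" and p1 p2 p3 :: nat
  assumes p1_pos: "1 \<le> p1" and p12: "p1 \<le> p2" and p23: "p2 \<le> p3"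
    and X_1: "X 1 = 1"
    and step0: "1 \<le> a \<Longrightarrow> 1 \<le> b \<Longrightarrow> a + b \<le> p1 \<Longrightarrow> X (a + b) \<le> X a + X b"
    and step1: "1 \<le> a \<Longrightarrow> 1 \<le> b \<Longrightarrow> a + b \<le> p2 \<Longrightarrow> X (a + b) \<le> X a + X b + p1"
    and step2: "1 \<le> a \<Longrightarrow> 1 \<le> b \<Longrightarrow> a + b \<le> p3 \<Longrightarrow> X (a + b) \<le> X a + X b + 2 * p1"
begin

lemma X_le_phase0: "1 \<le> m \<Longrightarrow> m \<le> p1 \<Longrightarrow> X m \<le> m"
proof (induction m rule: nat_induct_at_least)
  case base
  show ?case using X_1 by simp
next
  case (Suc m)
  then show ?case using step0[of m 1] X_1 by simp
qed

text \<open>Pieces of length \<open>p1\<close> are cut off one at a time. Each costs at most its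
  length plus a surcharge \<open>p1\<close>, and \<open>(m - 1) div p1\<close> cuts leave a
  remainder between \<open>1\<close> and \<open>p1\<close>.\<close>

lemma X_le_phase1: "1 \<le> m \<Longrightarrow> m \<le> p2 \<Longrightarrow> X m \<le> m + real ((m - 1) div p1) * p1"
proof (induction m rule: less_induct)
  case (less m)
  show ?case
  proof (cases "m \<le> p1")
    case True
    then have "(m - 1) div p1 = 0" using less.prems by simp
    then show ?thesis using X_le_phase0[OF less.prems(1) True] by simp
  next
    case False
    then have "X m \<le> X p1 + X (m - p1) + p1"
      using step1[of p1 "m - p1"] p1_pos less.prems by simp
    moreover have "X p1 \<le> p1" using X_le_phase0 p1_pos by simp
    moreover have "X (m - p1) \<le> (m - p1) + real ((m - p1 - 1) div p1) * p1"
      using less.IH[of "m - p1"] less.prems p1_pos False by simp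
    moreover have "(m - 1) div p1 = Suc ((m - p1 - 1) div p1)"
      using le_div_geq[of p1 "m - 1"] p1_pos False by (simp add: diff_commute)
    moreover have "real (m - p1) = real m - p1" using False by simp
    ultimately show ?thesis by (simp add: algebra_simps)
  qed
qed

lemma X_mult_p1_le:
  assumes "1 \<le> k" "k * p1 \<le> p2"
  shows "X (k * p1) \<le> (2 * real k - 1) * p1"
proof -
  obtain k' where k: "k = Suc k'" using assms(1) by (cases k) auto
  have "(k * p1 - 1) div p1 = k'"
    using div_nat_eqI[of p1 k' "k * p1 - 1"] p1_pos by (simp add: k mult.commute)
  with X_le_phase1[of "k * p1"] assms p1_pos show ?thesis
    by (simp add: k algebra_simps)
qed

text \<open>Every gluing is charged the highest price \<open>2 * p1\<close>, so the piece length
  \<open>a\<close> can be chosen freely.\<close>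

lemma X_pieces:
  assumes "1 \<le> a" "1 \<le> r" "n * a + r \<le> p3"
  shows "X (n * a + r) \<le> n * (X a + 2 * p1) + X r"
  using assms(3)
proof (induction n)
  case (Suc n)
  then have "X (a + (n * a + r)) \<le> X a + X (n * a + r) + 2 * p1"
    using assms by (intro step2) auto
  with Suc show ?case by (simp add: algebra_simps)
qed simp

text \<open>Write \<open>p2 = k * p1 + u\<close> with \<open>u < p1\<close>. The last claim bounds
  \<open>H\<^sub>2\<close> through the split of \<open>p2 + 1\<close> into \<open>k * p1\<close> and
  \<open>u + 1\<close>; the second piece has length at most \<open>p1\<close> and carries no
  surcharge.\<close>

lemma p2_bounds:
  defines "k \<equiv> p2 div p1"
  shows "1 \<le> k" "k * p1 \<le> p2" "X (k * p1) \<le> (2 * real k - 1) * p1" "X p2 \<le> p2 + real k * p1"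
    and "\<exists>a b. 1 \<le> a \<and> 1 \<le> b \<and> a + b = p2 + 1 \<and> X a + X b - 1 \<le> p2 + (real k - 1) * p1"
proof -
  show k: "1 \<le> k" "k * p1 \<le> p2"
    using p1_pos p12 by (auto simp: k_def div_greater_zero_iff Suc_le_eq)
  then show k_le: "X (k * p1) \<le> (2 * real k - 1) * p1"
    by (rule X_mult_p1_le)
  have "(p2 - 1) div p1 \<le> k"
    by (simp add: k_def div_le_mono)
  then have "real ((p2 - 1) div p1) * p1 \<le> real k * p1"
    by (intro mult_right_mono) auto
  then show "X p2 \<le> p2 + real k * p1"
    using X_le_phase1[of p2] p1_pos p12 by linarith
  have u: "p2 mod p1 < p1" and p2: "p2 = k * p1 + p2 mod p1"
    using p1_pos by (auto simp: k_def)
  have p2': "real p2 = real k * p1 + real (p2 mod p1)"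
    using arg_cong[OF p2, of real] by simp
  have "X (p2 mod p1 + 1) \<le> p2 mod p1 + 1"
    using X_le_phase0[of "p2 mod p1 + 1"] u by simp
  then have "X (k * p1) + X (p2 mod p1 + 1) - 1 \<le> p2 + (real k - 1) * p1"
    using k_le p2' by (simp add: algebra_simps)
  then show "\<exists>a b. 1 \<le> a \<and> 1 \<le> b \<and> a + b = p2 + 1 \<and> X a + X b - 1 \<le> p2 + (real k - 1) * p1"
    using k p1_pos p2 by (intro exI[of _ "k * p1"] exI[of _ "p2 mod p1 + 1"]) auto
qed

text \<open>Removing one piece \<open>k * p1\<close> leaves less than
  \<open>k * p1 \<le> p2\<close>, where the bounds of phase 1 apply. The price \<open>2 * p1\<close>
  is thus paid only once for \<open>X\<close>, and not at all for \<open>H\<^sub>3\<close>.\<close>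

lemma p3_bounds_short:
  assumes k: "1 \<le> k" "k * p1 \<le> p2" and p3: "p3 < 2 * k * p1"
  defines "k' \<equiv> p3 div p1"
  shows "X p3 \<le> p3 + (real k' + 1) * p1" "X (k' * p1) \<le> 2 * real k' * p1"
    and "\<exists>a b. 1 \<le> a \<and> 1 \<le> b \<and> a + b = p3 + 1 \<and> X a + X b - 1 \<le> p3 + (real k' - 1) * p1"
proof -
  have kk': "k \<le> k'"
    using k p23 p1_pos by (simp add: k'_def less_eq_div_iff_mult_less_eq)
  have k_le: "X (k * p1) \<le> (2 * real k - 1) * p1"
    using k by (rule X_mult_p1_le)
  have div: "(p3 - k * p1) div p1 = k' - k"
    using p1_pos div_mult_self1[of p1 "p3 - k * p1" k] k p23 by (simp add: k'_def)
  have p3k: "real (p3 - k * p1) = real p3 - real k * p1"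
    using k p23 by (simp add: of_nat_diff)
  have k'k: "real (k' - k) = real k' - real k"
    using kk' by simp
  show "X p3 \<le> p3 + (real k' + 1) * p1"
  \<comment> \<open>This case is separate because the remainder \<open>p3 - k * p1\<close> may be
    empty, while \<open>step2\<close> requires two pieces of positive length.\<close>
  proof (cases "p3 = p2")
    case True
    then show ?thesis using p2_bounds(4) by (simp add: k'_def algebra_simps)
  next
    case False
    then have lt: "k * p1 < p3" using k p23 by simp
    have "(p3 - k * p1 - 1) div p1 \<le> k' - k"
      using div_le_mono[of "p3 - k * p1 - 1" "p3 - k * p1" p1] div by simp
    then have "real ((p3 - k * p1 - 1) div p1) * p1 \<le> real (k' - k) * p1"
      by (intro mult_right_mono) auto
    moreover have "X (p3 - k * p1) \<le> (p3 - k * p1) + real ((p3 - k * p1 - 1) div p1) * p1"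
      using lt p3 k by (intro X_le_phase1) auto
    moreover have "X p3 \<le> X (k * p1) + X (p3 - k * p1) + 2 * p1"
      using step2[of "k * p1" "p3 - k * p1"] k p1_pos lt by simp
    ultimately show ?thesis
      using k_le p3k k'k by (simp add: algebra_simps)
  qed
  show "X (k' * p1) \<le> 2 * real k' * p1"
  proof (cases "k' = k")
    case True
    then show ?thesis using k_le by (simp add: algebra_simps)
  next
    case False
    have k'p: "k' * p1 \<le> p3" by (simp add: k'_def)
    have "k' * p1 < (2 * k) * p1"
      using k'p p3 by linarith
    then have "k' < 2 * k" by simp
    then have "(k' - k) * p1 \<le> k * p1" by (intro mult_right_mono) auto
    then have "(k' - k) * p1 \<le> p2" using k by linarith
    then have "X ((k' - k) * p1) \<le> (2 * real (k' - k) - 1) * p1"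
      using False kk' by (intro X_mult_p1_le) auto
    moreover have "k * p1 + (k' - k) * p1 = k' * p1"
      using kk' by (metis add_mult_distrib le_add_diff_inverse)
    then have "X (k' * p1) \<le> X (k * p1) + X ((k' - k) * p1) + 2 * p1"
      using step2[of "k * p1" "(k' - k) * p1"] k p1_pos False kk' k'p by simp
    ultimately show ?thesis
      using k_le k'k by (simp add: algebra_simps)
  qed
  have "X (p3 - k * p1 + 1) \<le> (p3 - k * p1 + 1) + real (k' - k) * p1"
    using X_le_phase1[of "p3 - k * p1 + 1"] p3 k div by simp
  then have "X (k * p1) + X (p3 - k * p1 + 1) - 1 \<le> p3 + (real k' - 1) * p1"
    using k_le p3k k'k by (simp add: algebra_simps)
  then show "\<exists>a b. 1 \<le> a \<and> 1 \<le> b \<and> a + b = p3 + 1 \<and> X a + X b - 1 \<le> p3 + (real k' - 1) * p1"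
    using k p23 p1_pos by (intro exI[of _ "k * p1"] exI[of _ "p3 - k * p1 + 1"]) auto
qed

text \<open>Here \<open>p3\<close> is cut into \<open>n\<close> pieces of length \<open>a\<close>
  and a remainder \<open>v\<close>, to which phase 1 applies. The term \<open>h\<close> bounds
  \<open>n\<close> pieces joined by \<open>n - 1\<close> gluings; \<open>X p3\<close> needs one
  gluing more, whereas the split of \<open>p3 + 1\<close> for \<open>H\<^sub>3\<close> saves
  it.\<close>

lemma p3_bounds_long:
  fixes a n v :: nat and h :: real
  assumes a: "1 \<le> a" "a \<le> p2"
  defines "n \<equiv> p3 div a" and "v \<equiv> p3 mod a"
  defines "h \<equiv> real n * X a + 2 * (real n - 1) * p1"
  shows "X (n * a) \<le> h" "X p3 \<le> h + 2 * real p1 + v + real (v div p1) * p1"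
    and "\<exists>b c. 1 \<le> b \<and> 1 \<le> c \<and> b + c = p3 + 1 \<and> X b + X c - 1 \<le> h + v + real (v div p1) * p1"
proof -
  obtain n' where n': "n = Suc n'"
    using a p23 by (cases n) (auto simp: n_def div_eq_0_iff)
  have v: "v < a" and p3: "p3 = n * a + v"
    using a by (auto simp: n_def v_def)
  show n_le: "X (n * a) \<le> h"
    using X_pieces[of a a n'] a p3 by (simp add: h_def n' algebra_simps)
  show "X p3 \<le> h + 2 * real p1 + v + real (v div p1) * p1"
  proof (cases "v = 0")
    case True
    then show ?thesis using n_le p3 by simp
  next
    case False
    have "X p3 \<le> n * (X a + 2 * p1) + X v"
      using X_pieces[of a v n] a False p3 by simp
    moreover have "X v \<le> v + real ((v - 1) div p1) * p1"
      using False v a by (intro X_le_phase1) auto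
    moreover have "real ((v - 1) div p1) * p1 \<le> real (v div p1) * p1"
      by (intro mult_right_mono of_nat_mono div_le_mono) auto
    ultimately show ?thesis by (simp add: h_def algebra_simps)
  qed
  have "X (n' * a + (v + 1)) \<le> n' * (X a + 2 * p1) + X (v + 1)"
    using a p3 by (intro X_pieces) (auto simp: n')
  moreover have "X (v + 1) \<le> v + 1 + real (v div p1) * p1"
    using X_le_phase1[of "v + 1"] v a by simp
  ultimately have "X a + X (n' * a + (v + 1)) - 1 \<le> h + v + real (v div p1) * p1"
    by (simp add: h_def n' algebra_simps)
  then show "\<exists>b c. 1 \<le> b \<and> 1 \<le> c \<and> b + c = p3 + 1 \<and> X b + X c - 1 \<le> h + v + real (v div p1) * p1"
    using a p3 by (intro exI[of _ a] exI[of _ "n' * a + (v + 1)"]) (auto simp: n')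
qed

section \<open>Quadratic bounds on the slope\<close>

lemma slope_le_4:
  assumes B: "\<And>a b. 1 \<le> a \<Longrightarrow> 1 \<le> b \<Longrightarrow> a + b = p2 + 1 \<Longrightarrow> B \<le> 2 * p1 + (X a + X b - 1)"
    and D: "\<And>m. 1 \<le> m \<Longrightarrow> m \<le> p3 \<Longrightarrow> D * m \<le> X m + B"
  shows "D \<le> 1/2 * (sqrt 13 + 5)"
proof (cases "D \<le> 4")
  case True
  have "3 \<le> sqrt 13" by (rule real_le_rsqrt) simp
  with True show ?thesis by simp
next
  case False
  define k where "k = p2 div p1"
  define P U where "P = real p1" and "U = real (p2 mod p1)"
  note k = p2_bounds[folded k_def, folded P_def]
  have P: "0 < P" and U: "0 \<le> U" using p1_pos by (auto simp: P_def U_def)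
  have p2: "real p2 = real k * P + U"
    unfolding P_def U_def k_def by (metis div_mult_mod_eq of_nat_add of_nat_mult)
  have B_le: "B \<le> (2 * real k + 1) * P + U"
    using k(5) B p2 by (fastforce simp: P_def algebra_simps)
  \<comment> \<open>Evaluation at \<open>k * p1\<close> and at \<open>p2\<close> gives two
    inequalities linear in \<open>P\<close> and \<open>U\<close>. Since \<open>D > 4\<close>, the
    factor \<open>k\<close> can be lowered to \<open>1\<close>, and eliminating \<open>U\<close>
    leaves a quadratic inequality in \<open>D\<close>.\<close>
  have 1: "(D - 4) * (real k * P) \<le> U"
    using D[of "k * p1"] k(1,2,3) p1_pos p23 B_le by (simp add: algebra_simps flip: P_def)
  have 2: "(D - 4) * (real k * P) + (D - 4 + 2) * U \<le> P"
    using D[of p2] k(4) p1_pos p12 p23 B_le p2 by (simp add: algebra_simps)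
  have "P \<le> real k * P" using k(1) P by simp
  then have 3: "(D - 4) * P \<le> (D - 4) * (real k * P)"
    using False by (intro mult_left_mono) auto
  have "(D - 4 + 2) * ((D - 4) * P) \<le> (D - 4 + 2) * U"
    using 1 3 False by (intro mult_left_mono) linarith+
  with 2 3 have "P * ((D - 4) + (D - 4 + 2) * (D - 4)) \<le> P * 1"
    by (simp add: algebra_simps)
  then have "(D - 4) + (D - 4 + 2) * (D - 4) \<le> 1"
    using P mult_le_cancel_left_pos by blast
  \<comment> \<open>The inequality is \<open>D^2 - 5 * D + 3 \<le> 0\<close>, that is,
    \<open>(2 * D - 5)^2 \<le> 13\<close>.\<close>
  then have "2 * D - 5 \<le> sqrt 13"
    by (intro real_le_rsqrt) (simp add: algebra_simps power2_eq_square)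
  then show ?thesis by simp
qed

text \<open>The extremal case is \<open>k = 1\<close>: evaluation at \<open>p1\<close> and
  \<open>p2\<close> and elimination of \<open>U\<close> give \<open>D^2 - 6 * D + 3 \<le> 0\<close>.
  For \<open>k \<ge> 2\<close> the slope cannot exceed \<open>136/25\<close>.\<close>

lemma slope_le_5:
  assumes B2: "\<And>a b. 1 \<le> a \<Longrightarrow> 1 \<le> b \<Longrightarrow> a + b = p2 + 1 \<Longrightarrow> B \<le> 2 * p1 + 2 * (X a + X b - 1)"
    and B3: "\<And>a b. 1 \<le> a \<Longrightarrow> 1 \<le> b \<Longrightarrow> a + b = p3 + 1 \<Longrightarrow> B \<le> 3 * p1 + (X a + X b - 1)"
    and D: "\<And>m. 1 \<le> m \<Longrightarrow> m \<le> p3 \<Longrightarrow> D * m \<le> X m + B"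
  shows "D \<le> 1/2 * (sqrt 24 + 6)"
\<comment> \<open>The threshold is a rational just below the claimed bound. Above it,
  \<open>D\<close> can be replaced by this number in the cases to be refuted, which makes them
  linear.\<close>
proof (cases "D \<le> 136/25")
  case True
  have "122/25 \<le> sqrt 24" by (rule real_le_rsqrt) (simp add: power2_eq_square)
  with True show ?thesis by simp
next
  case False
  then have D_mono: "136/25 * real m \<le> D * m" for m
    by (intro mult_right_mono) auto
  define k where "k = p2 div p1"
  define P U where "P = real p1" and "U = real (p2 mod p1)"
  note k = p2_bounds[folded k_def, folded P_def]
  have P: "0 < P" and U: "0 \<le> U" "U < P" using p1_pos by (auto simp: P_def U_def)
  have p2: "real p2 = real k * P + U"
    unfolding P_def U_def k_def by (metis div_mult_mod_eq of_nat_add of_nat_mult)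
  have B_le: "B \<le> 4 * (real k * P) + 2 * U"
  proof -
    obtain a b where "1 \<le> a" "1 \<le> b" "a + b = p2 + 1" "X a + X b - 1 \<le> p2 + (real k - 1) * P"
      using k(5) by blast
    with B2[of a b] p2 show ?thesis by (simp add: P_def algebra_simps)
  qed
  show ?thesis
  proof (cases "k = 1")
    case True
    define e where "e = 6 - D"
    have 1: "(1 - e) * P \<le> 2 * U"
      using D[of p1] k(3) p1_pos p12 p23 B_le by (simp add: True e_def algebra_simps flip: P_def)
    have 2: "(3 - e) * U \<le> e * P"
      using D[of p2] k(4) p1_pos p12 p23 B_le p2 by (simp add: True e_def algebra_simps)
    have "(3 - e) * ((1 - e) * P) \<le> (3 - e) * (2 * U)"
      using 1 False by (intro mult_left_mono) (auto simp: e_def)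
    with 2 have "P * ((3 - e) * (1 - e)) \<le> P * (2 * e)"
      by (simp add: algebra_simps)
    then have "(3 - e) * (1 - e) \<le> 2 * e"
      using P mult_le_cancel_left_pos by blast
    then have "2 * D - 6 \<le> sqrt 24"
      by (intro real_le_rsqrt) (simp add: e_def algebra_simps power2_eq_square)
    then show ?thesis by simp
  next
    case k2: False
    with k(1) have "2 \<le> k" by simp
    then have kP: "2 * P \<le> real k * P" using P by simp
    have False
    \<comment> \<open>For short \<open>p3\<close> the offset is bounded through
      \<open>H\<^sub>3\<close> and the slope is evaluated at \<open>k' * p1\<close> and
      \<open>p3\<close>. Otherwise the bound through \<open>H\<^sub>2\<close> and the single point
      \<open>2 * k * p1\<close> suffice.\<close>
    proof (cases "p3 < 2 * k * p1")
      case True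
      define k' where "k' = p3 div p1"
      define V where "V = real (p3 mod p1)"
      note k' = p3_bounds_short[OF k(1,2) True, folded k'_def, folded P_def]
      have V: "0 \<le> V" "V < P" using p1_pos by (auto simp: P_def V_def)
      have p3: "real p3 = real k' * P + V"
        unfolding P_def V_def k'_def by (metis div_mult_mod_eq of_nat_add of_nat_mult)
      have "k \<le> k'" using div_le_mono[OF p23] by (simp add: k_def k'_def)
      then have k'P: "real k * P \<le> real k' * P" using P by simp
      obtain a b where "1 \<le> a" "1 \<le> b" "a + b = p3 + 1" "X a + X b - 1 \<le> p3 + (real k' - 1) * P"
        using k'(3) by blast
      with B3[of a b] p3 have B_le': "B \<le> 2 * P + 2 * (real k' * P) + V"
        by (simp add: P_def algebra_simps)
      have "k' * p1 \<le> p3" "1 \<le> k' * p1"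
        using p1_pos \<open>2 \<le> k\<close> \<open>k \<le> k'\<close> by (auto simp: k'_def)
      then have "D * real (k' * p1) \<le> X (k' * p1) + B"
        by (intro D)
      with D_mono[of "k' * p1"] have "36 * (real k' * P) \<le> 50 * P + 25 * V"
        using k'(2) B_le' by (simp add: P_def)
      moreover have "36 * (real k' * P) + 86 * V \<le> 75 * P"
        using D_mono[of p3] D[of p3] k'(1) B_le' p3 p1_pos p12 p23 by (simp add: algebra_simps)
      ultimately show False using kP k'P P V by linarith
    next
      case False
      have eq: "2 * k * p1 = k * p1 + k * p1" by simp
      have "X (2 * k * p1) \<le> X (k * p1) + X (k * p1) + 2 * p1"
        unfolding eq using k(1) p1_pos False by (intro step2) auto
      then have "X (2 * k * p1) \<le> 4 * (real k * P)"
        using k(3) by (simp add: P_def algebra_simps)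
      moreover have "D * real (2 * k * p1) \<le> X (2 * k * p1) + B"
        using False k(1) p1_pos by (intro D) auto
      ultimately have "136/25 * (2 * (real k * P)) \<le> 8 * (real k * P) + 2 * U"
        using D_mono[of "2 * k * p1"] B_le by (simp add: P_def)
      then show False using kP P U by linarith
    qed
    then show ?thesis ..
  qed
qed

text \<open>In the extremal case \<open>p3 < 2 * k * p1\<close> and \<open>k' = k\<close>. Adding
  the evaluations at \<open>p2\<close> and \<open>p3\<close> leaves only the sum
  \<open>U + V\<close>, which the evaluation at \<open>k * p1\<close> bounds from below; the result
  is \<open>D^2 - 7 * D + 3 \<le> 0\<close>. All other cases contradict \<open>D > 327/50\<close>, a
  threshold just below the bound.\<close>

lemma slope_le_6:
  assumes B: "\<And>a b a' b'. 1 \<le> a \<Longrightarrow> 1 \<le> b \<Longrightarrow> a + b = p2 + 1 \<Longrightarrow>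
      1 \<le> a' \<Longrightarrow> 1 \<le> b' \<Longrightarrow> a' + b' = p3 + 1 \<Longrightarrow>
      B \<le> 3 * p1 + (X a + X b - 1) + (X a' + X b' - 1)"
    and D: "\<And>m. 1 \<le> m \<Longrightarrow> m \<le> p3 \<Longrightarrow> D * m \<le> X m + B"
  shows "D \<le> 1/2 * (sqrt 37 + 7)"
proof (cases "D \<le> 327/50")
  case True
  have "152/25 \<le> sqrt 37" by (rule real_le_rsqrt) (simp add: power2_eq_square)
  with True show ?thesis by simp
next
  case False
  then have D_mono: "327/50 * real m \<le> D * m" for m
    by (intro mult_right_mono) auto
  define k where "k = p2 div p1"
  define k' where "k' = p3 div p1"
  define P U V where "P = real p1" and "U = real (p2 mod p1)" and "V = real (p3 mod p1)"
  note k = p2_bounds[folded k_def, folded P_def]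
  have P: "0 < P" and U: "0 \<le> U" "U < P" and V: "0 \<le> V" "V < P"
    using p1_pos by (auto simp: P_def U_def V_def)
  have p2: "real p2 = real k * P + U" and p3: "real p3 = real k' * P + V"
    unfolding P_def U_def V_def k_def k'_def by (metis div_mult_mod_eq of_nat_add of_nat_mult)+
  have kk': "k \<le> k'" using div_le_mono[OF p23] by (simp add: k_def k'_def)
  have k'p: "k' * p1 \<le> p3" "1 \<le> k' * p1"
    using p1_pos k(1) kk' by (auto simp: k'_def)
  have B_le: "B \<le> 2 * P + 2 * (real k * P) + U + H"
    if H: "\<exists>a b. 1 \<le> a \<and> 1 \<le> b \<and> a + b = p3 + 1 \<and> X a + X b - 1 \<le> H" for H
  proof -
    obtain a b where "1 \<le> a" "1 \<le> b" "a + b = p2 + 1" "X a + X b - 1 \<le> p2 + (real k - 1) * P"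
      using k(5) by blast
    moreover obtain a' b' where "1 \<le> a'" "1 \<le> b'" "a' + b' = p3 + 1" "X a' + X b' - 1 \<le> H"
      using H by blast
    ultimately show ?thesis
      using B[of a b a' b'] p2 by (simp add: P_def algebra_simps)
  qed
  show ?thesis
  proof (cases "p3 < 2 * k * p1")
    case True
    note s = p3_bounds_short[OF k(1,2) True, folded k'_def, folded P_def]
    have B_le': "B \<le> 2 * (real k * P) + 2 * (real k' * P) + U + V + P"
      using B_le[OF s(3)] p3 by (simp add: algebra_simps)
    show ?thesis
    proof (cases "k' = k")
      case True
      have 1: "(D - 6) * (real k * P) \<le> U + V"
        using D[of "k * p1"] k(1,2,3) p1_pos p23 B_le' by (simp add: True algebra_simps flip: P_def)
      have 2: "(D - 6) * (real k * P) + (D - 6 + 4) * U \<le> P + V"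
        using D[of p2] k(4) p1_pos p12 p23 B_le' p2 by (simp add: True algebra_simps)
      have 3: "(D - 6) * (real k * P) + (D - 6 + 4) * V \<le> 2 * P + U"
        using D[of p3] s(1) p1_pos p12 p23 B_le' p3 by (simp add: True algebra_simps)
      have "P \<le> real k * P" using k(1) P by simp
      then have 4: "(D - 6) * P \<le> (D - 6) * (real k * P)"
        using False by (intro mult_left_mono) linarith+
      have "(D - 6 + 3) * ((D - 6) * P) \<le> (D - 6 + 3) * (U + V)"
        using 1 4 False by (intro mult_left_mono) linarith+
      with 2 3 4 have "P * ((D - 6) * 2 + (D - 6 + 3) * (D - 6)) \<le> P * 3"
        by (simp add: algebra_simps)
      then have "(D - 6) * 2 + (D - 6 + 3) * (D - 6) \<le> 3"
        using P mult_le_cancel_left_pos by blast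
      then have "2 * D - 7 \<le> sqrt 37"
        by (intro real_le_rsqrt) (simp add: algebra_simps power2_eq_square)
      then show ?thesis by simp
    next
      case k'k: False
      then have "real k + 1 \<le> real k'" using kk' by simp
      then have "(real k + 1) * P \<le> real k' * P" using P by (intro mult_right_mono) auto
      then have "real k * P + P \<le> real k' * P" by (simp add: algebra_simps)
      moreover have "2 \<le> real k'" using \<open>real k + 1 \<le> real k'\<close> k(1) by simp
      then have "2 * P \<le> real k' * P" using P by (intro mult_right_mono) auto
      moreover have "127 * (real k' * P) \<le> 100 * (real k * P) + 50 * U + 50 * V + 50 * P"
        using D_mono[of "k' * p1"] D[OF k'p(2,1)] s(2) B_le' by (simp add: P_def)
      ultimately have False using U V P by linarith
      then show ?thesis ..
    qed
  next
    case long: False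
    have False
    proof (cases "k = 1")
      case False
      define a where "a = k * p1"
      define n where "n = p3 div a"
      define v where "v = p3 mod a"
      define R where "R = real (v div p1) * P"
      define h where "h = real n * X a + 2 * (real n - 1) * P"
      have k2: "2 \<le> k" using False k(1) by simp
      have a: "1 \<le> a" "a \<le> p2" using k(1,2) p1_pos by (auto simp: a_def)
      note l = p3_bounds_long[OF a, folded n_def v_def, folded P_def, folded h_def R_def]
      have n2: "2 \<le> n"
        using long a by (simp add: n_def a_def less_eq_div_iff_mult_less_eq mult.assoc)
      have R: "R \<le> v"
        unfolding R_def P_def by (metis div_times_less_eq_dividend of_nat_le_iff of_nat_mult)
      have Xa: "X a \<le> (2 * real k - 1) * P" using k(3) by (simp add: a_def P_def)
      then have "real n * X a \<le> real n * ((2 * real k - 1) * P)"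
        by (intro mult_left_mono) auto
      then have h: "h \<le> 2 * (real n * real k * P) + real n * P - 2 * P"
        by (simp add: h_def algebra_simps)
      have "p3 = n * a + v" by (simp add: n_def v_def)
      then have p3': "real p3 = real n * real k * P + v"
        by (simp add: a_def P_def)
      \<comment> \<open>The single evaluation at \<open>p3\<close> suffices, since \<open>n\<close>
        and \<open>k\<close> are at least \<open>2\<close> and so \<open>n * k\<close> is at least
        \<open>n + k\<close>.\<close>
      have "327/50 * real p3 \<le> 2 * h + 4 * P + 2 * (real k * P) + U + 2 * v + 2 * R"
        using D_mono[of p3] D[of p3] B_le[OF l(3)] l(2) p1_pos p12 p23 by linarith
      then have "127 * (real n * real k * P) \<le> 100 * (real n * P) + 100 * (real k * P) + 50 * U"
        using p3' h R by simp
      moreover have "2 * real k \<le> real n * real k" "2 * real n \<le> real n * real k"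
        using k2 n2 by simp_all
      then have "2 * real k * P \<le> real n * real k * P" "2 * real n * P \<le> real n * real k * P"
        using P by (auto intro!: mult_right_mono)
      moreover have "2 * P \<le> real k * P" "2 * P \<le> real n * P" using k2 n2 P by simp_all
      ultimately show False using U P by (simp add: mult.assoc)
    next
      case True
      have p3_ge: "2 * p1 \<le> p3" using long True by simp
      have k'2: "2 \<le> k'"
        using p3_ge p1_pos by (simp add: k'_def less_eq_div_iff_mult_less_eq)
      have "p3 mod p1 div p1 = 0" using p1_pos by simp
      note l = p3_bounds_long[of p1, OF p1_pos p12, folded k'_def, folded P_def V_def, unfolded this]
      have "real k' * X p1 \<le> real k' * P"
        unfolding P_def using X_le_phase0[of p1] p1_pos by (intro mult_left_mono) auto
      then have h: "real k' * X p1 + 2 * (real k' - 1) * P \<le> 3 * (real k' * P) - 2 * P"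
        by (simp add: algebra_simps)
      have B_le': "B \<le> 2 * P + U + 3 * (real k' * P) + V"
        using B_le[OF l(3)] h by (simp add: True)
      have 1: "27 * (real k' * P) \<le> 50 * U + 50 * V"
        using D_mono[of "k' * p1"] D[OF k'p(2,1)] l(1) h B_le' by (simp flip: P_def)
      have 2: "27 * (real k' * P) + 227 * V \<le> 100 * P + 50 * U"
        using D_mono[of p3] D[of p3] l(2) h p3 B_le' p1_pos p12 p23 by simp
      show False
      proof (cases "k' = 2")
        case False
        with k'2 have "3 \<le> real k'" by simp
        then have "3 * P \<le> real k' * P" using P by (intro mult_right_mono) auto
        with 1 2 U V P show False by linarith
      next
        case k'_eq: True
        \<comment> \<open>Inequalities \<open>1\<close> and \<open>2\<close> alone leave
          \<open>k' = 2\<close> open. Now \<open>V < U\<close> gives \<open>p3 - p1 < p2\<close>, so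
          \<open>p3 + 1\<close> splits into \<open>p1\<close> and a piece still in phase 1. This
          lowers the bound on \<open>H\<^sub>3\<close> from \<open>4 * P + V\<close> to
          \<open>3 * P + V\<close>, and evaluation at \<open>2 * p1\<close> then gives a
          contradiction.\<close>
        from 1 2 U have "V < U" by (simp add: k'_eq)
        with p2 p3 have "real p3 < real (p2 + p1)" by (simp add: True k'_eq P_def)
        then have p3_less: "p3 < p2 + p1" by simp
        have "(p3 - p1) div p1 = 1"
          using k'_eq p1_pos p3_ge by (simp add: k'_def le_div_geq)
        then have "X (p3 - p1 + 1) \<le> (p3 - p1 + 1) + P"
          using X_le_phase1[of "p3 - p1 + 1"] p3_less p3_ge by (simp add: P_def)
        moreover have "X p1 \<le> P" using X_le_phase0[of p1] p1_pos by (simp add: P_def)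
        ultimately have "X p1 + X (p3 - p1 + 1) - 1 \<le> 3 * P + V"
          using p3 p3_ge by (simp add: k'_eq P_def of_nat_diff)
        then have "\<exists>a b. 1 \<le> a \<and> 1 \<le> b \<and> a + b = p3 + 1 \<and> X a + X b - 1 \<le> 3 * P + V"
          using p1_pos p3_ge by (intro exI[of _ p1] exI[of _ "p3 - p1 + 1"]) auto
        from B_le[OF this] have "B \<le> 7 * P + U + V" by (simp add: True)
        moreover have "X (p1 + p1) \<le> X p1 + X p1 + 2 * P"
          using step2[of p1 p1] p1_pos p3_ge by (simp add: P_def)
        moreover have "D * real (p1 + p1) \<le> X (p1 + p1) + B"
          using p1_pos p3_ge by (intro D) auto
        ultimately have "327/50 * real (p1 + p1) \<le> 11 * P + U + V"
          using D_mono[of "p1 + p1"] \<open>X p1 \<le> P\<close> by linarith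
        then have "654/50 * P \<le> 11 * P + U + V"
          by (simp add: P_def)
        with U V P show False by linarith
      qed
    qed
    then show ?thesis ..
  qed
qed

end

section \<open>From sequences to the staircase inequalities\<close>

lemma staircase_of_seq:
  assumes \<alpha>: "\<alpha> \<in> W l c" and l: "1 \<le> l" and c: "4 \<le> c"
    and X_def: "X = (\<lambda>m. real_of_int (x_val \<alpha> 1 (m - 1)) + 1)"
    and Y_def: "Y = (\<lambda>i. real_of_int (x_val \<alpha> 2 i))"
  obtains p1 p2 p3 where "staircase X p1 p2 p3" "p3 \<le> l" "Y 1 \<le> p1"
    "\<And>a b. 1 \<le> a \<Longrightarrow> 1 \<le> b \<Longrightarrow> a + b = p2 + 1 \<Longrightarrow> Y 2 \<le> p1 + X a + X b - 1"
    "\<And>a b. 1 \<le> a \<Longrightarrow> 1 \<le> b \<Longrightarrow> a + b = p3 + 1 \<Longrightarrow> Y 3 \<le> 2 * real p1 + X a + X b - 1"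
proof -
  define G where "G = min_conv (x_val \<alpha> 2)"
  have cnt: "count_list \<alpha> 1 = l - 1" "count_list \<alpha> 2 = c - 1"
    using \<alpha> by (auto simp: W_def)
  obtain q1 where q1: "q1 < length \<alpha>" "\<alpha> ! q1 = 2" "nu \<alpha> q1 2 = 1"
    using ex_position[of 1 \<alpha> 2] cnt c by force
  obtain q2 where q2: "q2 < length \<alpha>" "\<alpha> ! q2 = 2" "nu \<alpha> q2 2 = 2"
    using ex_position[of 2 \<alpha> 2] cnt c by force
  obtain q3 where q3: "q3 < length \<alpha>" "\<alpha> ! q3 = 2" "nu \<alpha> q3 2 = 3"
    using ex_position[of 3 \<alpha> 2] cnt c by force
  define p1 p2 p3 where p: "p1 = nu \<alpha> q1 1" "p2 = nu \<alpha> q2 1" "p3 = nu \<alpha> q3 1"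
  have "q1 \<le> q2" "q2 \<le> q3"
    using nu_mono[of q2 q1 \<alpha> 2] nu_mono[of q3 q2 \<alpha> 2] q1 q2 q3 by (auto intro: leI)
  then have p_ord: "1 \<le> p1" "p1 \<le> p2" "p2 \<le> p3"
    by (simp_all only: p nu_mono nu_ge_1)
  have p3: "p3 \<le> l"
    using nu_mono[of q3 "length \<alpha>" \<alpha> 1] q3 cnt l by (simp add: p nu_length)
  \<comment> \<open>The split \<open>m = a + b\<close> corresponds to the split of the index
    \<open>m - 2\<close> into \<open>a - 1\<close> and \<open>b - 1\<close>; the shift in
    \<open>X\<close> absorbs the constant \<open>1\<close>. The equivalences say which of the first
    three twos have already occurred.\<close>
  have X_rec: "\<exists>t. X (a + b) \<le> G t + X a + X b
      \<and> (1 \<le> t \<longleftrightarrow> p1 < a + b) \<and> (2 \<le> t \<longleftrightarrow> p2 < a + b) \<and> (3 \<le> t \<longleftrightarrow> p3 < a + b)"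
    if ab: "1 \<le> a" "1 \<le> b" "a + b \<le> l" for a b
  proof -
    define m where "m = a + b"
    have "1 \<le> m - 1" "m - 1 \<le> count_list \<alpha> 1"
      using ab cnt by (auto simp: m_def)
    then obtain t where t:
      "x_val \<alpha> 1 (m - 1) = 1 + min_conv (x_val \<alpha> 1) (m - 1 - 1) + min_conv (x_val \<alpha> 2) t"
      "\<And>q. \<alpha> ! q = 2 \<Longrightarrow> nu \<alpha> q 2 \<le> t \<longleftrightarrow> nu \<alpha> q 1 \<le> m - 1"
      by (rule x_val_1_rec) blast
    have "X m \<le> G t + X a + X b"
      using min_conv_le[of "a - 1" "b - 1" "m - 1 - 1" "x_val \<alpha> 1"] ab t(1)
      by (simp add: X_def G_def m_def)
    then show ?thesis
      using t(2)[OF q1(2)] t(2)[OF q2(2)] t(2)[OF q3(2)] q1 q2 q3 ab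
      by (intro exI[of _ t]) (auto simp: p m_def)
  qed
  have X1: "X 1 = 1" by (simp add: X_def)
  have G0: "G 0 \<le> 0" using min_conv_le[of 0 0 0 "x_val \<alpha> 2"] by (simp add: G_def)
  have step0: "X (a + b) \<le> X a + X b" if ab: "1 \<le> a" "1 \<le> b" "a + b \<le> p1" for a b
  proof -
    obtain t where t: "X (a + b) \<le> G t + X a + X b" "\<not> 1 \<le> t"
      using X_rec[OF ab(1,2)] ab p_ord p3 by auto
    then have "t = 0" by simp
    with t G0 show ?thesis by auto
  qed
  \<comment> \<open>The argument of \<open>X_le_phase0\<close> is repeated because it yields
    \<open>Y 1 \<le> p1\<close>, on which \<open>step1\<close> and \<open>step2\<close> rest, before
    the locale can be instantiated.\<close>
  have "X p1 \<le> p1"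
  proof -
    have "X m \<le> m" if "1 \<le> m" "m \<le> p1" for m
      using that
    proof (induction m rule: nat_induct_at_least)
      case (Suc m)
      then show ?case using step0[of m 1] X1 by simp
    qed (use X1 in simp)
    with p_ord show ?thesis by simp
  qed
  then have Y1: "Y 1 \<le> p1"
    using x_val_rec[OF q1(1,2)] q1(3) G0 min_conv_le[of 0 "p1 - 1" "p1 - 1" "x_val \<alpha> 1"]
    by (simp add: Y_def X_def G_def p)
  have G1: "G 1 \<le> p1"
    using min_conv_le[of 0 1 1 "x_val \<alpha> 2"] Y1 by (simp add: G_def Y_def)
  have G2: "G 2 \<le> 2 * p1"
    using min_conv_le[of 1 1 2 "x_val \<alpha> 2"] Y1 by (simp add: G_def Y_def)
  have step1: "X (a + b) \<le> X a + X b + p1" if ab: "1 \<le> a" "1 \<le> b" "a + b \<le> p2" for a b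
  proof -
    obtain t where t: "X (a + b) \<le> G t + X a + X b" "\<not> 2 \<le> t"
      using X_rec[OF ab(1,2)] ab p_ord p3 by auto
    then have "t = 0 \<or> t = 1" by auto
    with t G0 G1 show ?thesis by auto
  qed
  have step2: "X (a + b) \<le> X a + X b + 2 * p1" if ab: "1 \<le> a" "1 \<le> b" "a + b \<le> p3" for a b
  proof -
    obtain t where t: "X (a + b) \<le> G t + X a + X b" "\<not> 3 \<le> t"
      using X_rec[OF ab(1,2)] ab p_ord p3 by auto
    then have "t = 0 \<or> t = 1 \<or> t = 2" by auto
    with t G0 G1 G2 show ?thesis by auto
  qed
  have Y2: "Y 2 \<le> p1 + X a + X b - 1" if "1 \<le> a" "1 \<le> b" "a + b = p2 + 1" for a b
    using x_val_rec[OF q2(1,2)] q2(3) G1 min_conv_le[of "a - 1" "b - 1" "p2 - 1" "x_val \<alpha> 1"] that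
    by (simp add: Y_def X_def G_def p)
  have Y3: "Y 3 \<le> 2 * real p1 + X a + X b - 1" if "1 \<le> a" "1 \<le> b" "a + b = p3 + 1" for a b
    using x_val_rec[OF q3(1,2)] q3(3) G2 min_conv_le[of "a - 1" "b - 1" "p3 - 1" "x_val \<alpha> 1"] that
    by (simp add: Y_def X_def G_def p)
  have "staircase X p1 p2 p3"
    by unfold_locales (use p_ord X1 step0 step1 step2 in auto)
  from that[OF this p3 Y1 Y2 Y3] show thesis .
qed

text \<open>The offset is estimated through the splits \<open>3 = 1 + 2\<close>,
  \<open>4 = 2 + 2 = 1 + 3\<close> and \<open>5 = 2 + 3\<close> of \<open>c - 1\<close>, which
  involve only the first three twos.\<close>

lemma delta_seq_upper:
  assumes \<alpha>: "\<alpha> \<in> W l c" and l: "1 \<le> l" and c: "4 \<le> c"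
  shows "c = 4 \<Longrightarrow> delta_seq l c \<alpha> \<le> 1/2 * (sqrt 13 + 5)"
    and "c = 5 \<Longrightarrow> delta_seq l c \<alpha> \<le> 1/2 * (sqrt 24 + 6)"
    and "c = 6 \<Longrightarrow> delta_seq l c \<alpha> \<le> 1/2 * (sqrt 37 + 7)"
proof -
  define X where "X = (\<lambda>m. real_of_int (x_val \<alpha> 1 (m - 1)) + 1)"
  define Y where "Y = (\<lambda>i. real_of_int (x_val \<alpha> 2 i))"
  define B where "B = real_of_int (min_conv (x_val \<alpha> 2) (c - 1))"
  have B_le: "B \<le> Y i + Y j" if "i + j = c - 1" for i j
    using min_conv_le[OF that, of "x_val \<alpha> 2"] by (simp add: B_def Y_def)
  obtain p1 p2 p3 where p: "staircase X p1 p2 p3" "p3 \<le> l" "Y 1 \<le> p1"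
    "\<And>a b. 1 \<le> a \<Longrightarrow> 1 \<le> b \<Longrightarrow> a + b = p2 + 1 \<Longrightarrow> Y 2 \<le> p1 + X a + X b - 1"
    "\<And>a b. 1 \<le> a \<Longrightarrow> 1 \<le> b \<Longrightarrow> a + b = p3 + 1 \<Longrightarrow> Y 3 \<le> 2 * real p1 + X a + X b - 1"
    by (rule staircase_of_seq[OF \<alpha> l c X_def Y_def]) (rule that)
  have D: "delta_seq l c \<alpha> * m \<le> X m + B" if "1 \<le> m" "m \<le> p3" for m
    using delta_seq_le[of m l c \<alpha>] that p(2) by (simp add: X_def B_def)
  show "delta_seq l c \<alpha> \<le> 1/2 * (sqrt 13 + 5)" if c: "c = 4"
  proof (rule staircase.slope_le_4[OF p(1) _ D])
    fix a b :: nat assume "1 \<le> a" "1 \<le> b" "a + b = p2 + 1"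
    from p(4)[OF this] p(3) B_le[of 1 2] c show "B \<le> 2 * p1 + (X a + X b - 1)" by simp
  qed
  show "delta_seq l c \<alpha> \<le> 1/2 * (sqrt 24 + 6)" if c: "c = 5"
  proof (rule staircase.slope_le_5[OF p(1) _ _ D])
    fix a b :: nat assume "1 \<le> a" "1 \<le> b" "a + b = p2 + 1"
    from p(4)[OF this] B_le[of 2 2] c show "B \<le> 2 * p1 + 2 * (X a + X b - 1)" by simp
  next
    fix a b :: nat assume "1 \<le> a" "1 \<le> b" "a + b = p3 + 1"
    from p(5)[OF this] p(3) B_le[of 1 3] c show "B \<le> 3 * p1 + (X a + X b - 1)" by simp
  qed
  show "delta_seq l c \<alpha> \<le> 1/2 * (sqrt 37 + 7)" if c: "c = 6"
  proof (rule staircase.slope_le_6[OF p(1) _ D])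
    fix a b a' b' :: nat
    assume ab: "1 \<le> a" "1 \<le> b" "a + b = p2 + 1" and ab': "1 \<le> a'" "1 \<le> b'" "a' + b' = p3 + 1"
    from p(4)[OF ab] p(5)[OF ab'] B_le[of 2 3] c
    show "B \<le> 3 * p1 + (X a + X b - 1) + (X a' + X b' - 1)" by simp
  qed
qed

subsection \<open>Sequences approaching the bounds\<close>

lemma count_list_replicate: "count_list (replicate n x) y = (if x = y then n else 0)"
  by (induction n) auto

text \<open>For \<open>1 \<le> p1 \<le> p2 \<le> p3\<close> the first three twos are preceded by
  \<open>p1 - 1\<close>, \<open>p2 - 1\<close> and \<open>p3 - 1\<close> ones. The further twos
  follow at once, so the list ends in a two.\<close>

definition staircase_seq :: "nat \<Rightarrow> nat \<Rightarrow> nat \<Rightarrow> nat \<Rightarrow> nat list" where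
  "staircase_seq p1 p2 p3 c = replicate (p1 - 1) 1 @ 2 # replicate (p2 - p1) 1 @ 2 #
     replicate (p3 - p2) 1 @ 2 # replicate (c - 4) 2"

section \<open>Lower bounds for the twos of a staircase sequence\<close>

context
  fixes p1 p2 p3 c :: nat and \<alpha> :: "nat list" and Y G :: "nat \<Rightarrow> int"
  assumes p: "1 \<le> p1" "p1 \<le> p2" "p2 \<le> p3" and c: "4 \<le> c"
  defines "\<alpha> \<equiv> staircase_seq p1 p2 p3 c"
  defines "Y \<equiv> x_val \<alpha> 2" and "G \<equiv> min_conv (x_val \<alpha> 2)"
begin

lemma staircase_seq_mem: "\<alpha> \<in> W p3 c"
  using p c by (auto simp: \<alpha>_def staircase_seq_def W_def count_list_replicate)

lemma staircase_seq_last: "\<alpha> ! (p3 + c - 2 - 1) = 2"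
proof -
  have "\<alpha> \<noteq> []" "last \<alpha> = 2"
    by (auto simp: \<alpha>_def staircase_seq_def)
  moreover have "length \<alpha> = p3 + c - 2"
    using staircase_seq_mem by (simp add: W_def)
  ultimately show ?thesis
    by (simp add: last_conv_nth)
qed

text \<open>One splitting for each two, in the form that \<open>x_val_2_ge\<close> expects;
  \<open>e\<close> counts the twos of the final block that come before the chosen one.\<close>

lemma staircase_seq_split:
  "\<alpha> = replicate (p1 - 1) 1 @ 2 # (replicate (p2 - p1) 1 @ 2 # replicate (p3 - p2) 1 @ 2 # replicate (c - 4) 2)"
  "\<alpha> = (replicate (p1 - 1) 1 @ 2 # replicate (p2 - p1) 1) @ 2 # (replicate (p3 - p2) 1 @ 2 # replicate (c - 4) 2)"
  "e \<le> c - 4 \<Longrightarrow> \<alpha> = (replicate (p1 - 1) 1 @ 2 # replicate (p2 - p1) 1 @ 2 # replicate (p3 - p2) 1 @ replicate e 2)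
     @ 2 # replicate (c - 4 - e) 2"
proof -
  assume "e \<le> c - 4"
  then have "2 # replicate (c - 4) 2 = replicate e 2 @ 2 # replicate (c - 4 - e) (2 :: nat)"
    by (metis add_Suc_right le_add_diff_inverse replicate_Suc replicate_add)
  then show "\<alpha> = (replicate (p1 - 1) 1 @ 2 # replicate (p2 - p1) 1 @ 2 # replicate (p3 - p2) 1 @ replicate e 2)
     @ 2 # replicate (c - 4 - e) 2"
    by (simp add: \<alpha>_def staircase_seq_def)
qed (simp_all add: \<alpha>_def staircase_seq_def)

text \<open>A bound on \<open>G n\<close> yields one on \<open>Y (n + 1)\<close>, while
  \<open>G n\<close> depends only on the entries up to \<open>Y n\<close>. The estimates below
  alternate between the two.\<close>

lemma Y_ge:
  "p1 + G 0 \<le> Y 1" "p2 + G 1 \<le> Y 2" "e \<le> c - 4 \<Longrightarrow> p3 + G (2 + e) \<le> Y (3 + e)"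
proof -
  show "p1 + G 0 \<le> Y 1"
    using x_val_2_ge[OF staircase_seq_split(1)] p by (simp add: Y_def G_def count_list_replicate)
  show "p2 + G 1 \<le> Y 2"
    using x_val_2_ge[OF staircase_seq_split(2)] p
    by (simp add: Y_def G_def count_list_replicate numeral_2_eq_2)
  show "p3 + G (2 + e) \<le> Y (3 + e)" if "e \<le> c - 4"
    using x_val_2_ge[OF staircase_seq_split(3)[OF that]] p
    by (simp add: Y_def G_def count_list_replicate numeral_3_eq_3)
qed

lemma G_ge: "(\<And>i j. i + j = n \<Longrightarrow> i \<le> j \<Longrightarrow> z \<le> Y i + Y j) \<Longrightarrow> z \<le> G n"
  unfolding G_def Y_def by (intro min_conv_ge) (metis add.commute nat_le_linear)

lemma Y_0: "Y 0 = 0"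
  by (simp add: Y_def)

lemma G_0_ge: "0 \<le> G 0"
  by (simp add: G_def min_conv_x_val_nonneg)

lemma Y_1_ge: "p1 \<le> Y 1"
  using Y_ge(1) G_0_ge by simp

lemma G_1_ge: "p1 \<le> G 1"
proof (rule G_ge)
  fix i j :: nat assume "i + j = 1" "i \<le> j"
  then have "i = 0 \<and> j = 1" by auto
  then show "p1 \<le> Y i + Y j" using Y_0 Y_1_ge by simp
qed

lemma Y_2_ge: "p1 + p2 \<le> Y 2"
  using Y_ge(2) G_1_ge by simp

lemma G_2_ge: "2 * p1 \<le> G 2"
proof (rule G_ge)
  fix i j :: nat assume "i + j = 2" "i \<le> j"
  then have "i = 0 \<and> j = 2 \<or> i = 1 \<and> j = 1" by auto
  then show "(2 * p1) \<le> Y i + Y j" using Y_0 Y_1_ge Y_2_ge p by auto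
qed

lemma Y_3_ge: "2 * p1 + p3 \<le> Y 3"
  using Y_ge(3)[of 0] G_2_ge by simp

lemma G_3_ge: "2 * p1 + p2 \<le> G 3"
proof (rule G_ge)
  fix i j :: nat assume "i + j = 3" "i \<le> j"
  then have "i = 0 \<and> j = 3 \<or> i = 1 \<and> j = 2" by auto
  then show "(2 * p1 + p2) \<le> Y i + Y j" using Y_0 Y_1_ge Y_2_ge Y_3_ge p by auto
qed

text \<open>The two terms come from the splits \<open>1 + 3\<close> and \<open>2 + 2\<close>. The
  bound for \<open>0 + 4\<close> is at least the second term because
  \<open>p2 \<le> p3\<close>.\<close>

lemma G_4_ge:
  assumes "5 \<le> c" shows "min (3 * p1 + p3) (2 * p1 + 2 * p2) \<le> G 4"
proof (rule G_ge)
  have Y4: "2 * p1 + p2 + p3 \<le> Y 4"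
    using Y_ge(3)[of 1] G_3_ge assms by (simp add: Suc_le_eq)
  fix i j :: nat assume "i + j = 4" "i \<le> j"
  then have "i = 0 \<and> j = 4 \<or> i = 1 \<and> j = 3 \<or> i = 2 \<and> j = 2" by auto
  then show "min (3 * p1 + p3) (2 * p1 + 2 * p2) \<le> Y i + Y j"
    using Y_0 Y_1_ge Y_2_ge Y_3_ge Y4 p by auto
qed

text \<open>The splits \<open>1 + 4\<close> and \<open>2 + 3\<close> have the same lower bound, and
  that of \<open>0 + 5\<close> is no smaller.\<close>

lemma G_5_ge:
  assumes "6 \<le> c" shows "3 * p1 + p2 + p3 \<le> G 5"
proof (rule G_ge)
  have Y4: "2 * p1 + p2 + p3 \<le> Y 4"
    using Y_ge(3)[of 1] G_3_ge assms by (simp add: Suc_le_eq)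
  have Y5: "min (3 * p1 + p3) (2 * p1 + 2 * p2) + p3 \<le> Y 5"
  proof -
    have "2 \<le> c - 4" using assms by linarith
    then show ?thesis using Y_ge(3)[of 2] G_4_ge assms by simp
  qed
  fix i j :: nat assume "i + j = 5" "i \<le> j"
  then have "i = 0 \<and> j = 5 \<or> i = 1 \<and> j = 4 \<or> i = 2 \<and> j = 3" by auto
  then show "(3 * p1 + p2 + p3) \<le> Y i + Y j"
    using Y_0 Y_1_ge Y_2_ge Y_3_ge Y4 Y5 p by auto
qed

text \<open>From \<open>x_val \<alpha> 1 j \<ge> j + G t\<close> and
  \<open>beta c \<alpha> = 1 + G (c - 1)\<close> it remains to bound \<open>z * (j + 1)\<close> by
  \<open>G t + G (c - 1)\<close>. Within a phase the left side is largest at the right end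
  \<open>p1\<close>, \<open>p2\<close> or \<open>p3\<close>, and \<open>G t\<close> is at least
  \<open>t * p1\<close>.\<close>

lemma delta_seq_ge:
  fixes z :: real
  assumes z: "0 \<le> z" "z * p1 \<le> G (c - 1)" "z * p2 \<le> p1 + G (c - 1)" "z * p3 \<le> 2 * p1 + G (c - 1)"
  shows "1 + z \<le> delta_seq p3 c \<alpha>"
proof -
  have cnt: "count_list \<alpha> 1 = p3 - 1"
    using staircase_seq_mem by (simp add: W_def)
  have "1 + z \<le> real_of_int (x_val \<alpha> 1 j + beta c \<alpha>) / real (j + 1)" if j: "j \<le> p3 - 1" for j
  proof -
    obtain t where t: "int j + G t \<le> x_val \<alpha> 1 j" "1 \<le> t \<longleftrightarrow> p1 \<le> j" "2 \<le> t \<longleftrightarrow> p2 \<le> j" "t \<le> 2"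
    proof (cases "j = 0")
      case True
      have "G 0 \<le> 0" using min_conv_le[of 0 0 0 Y] Y_0 by (simp add: G_def Y_def)
      with True p that[of 0] show thesis by simp
    next
      case False
      with j cnt have j': "1 \<le> j" "j \<le> count_list \<alpha> 1" by auto
      then obtain t where t:
        "x_val \<alpha> 1 j = 1 + min_conv (x_val \<alpha> 1) (j - 1) + min_conv (x_val \<alpha> 2) t"
        "\<And>q. \<alpha> ! q = 2 \<Longrightarrow> nu \<alpha> q 2 \<le> t \<longleftrightarrow> nu \<alpha> q 1 \<le> j"
        by (rule x_val_1_rec) blast
      have iff: "1 + count_list us 2 \<le> t \<longleftrightarrow> 1 + count_list us 1 \<le> j" if "\<alpha> = us @ 2 # vs" for us vs
        using t(2)[of "length us"] unfolding that nu_append_Cons by simp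
      have "int (j - 1) \<le> min_conv (x_val \<alpha> 1) (j - 1)"
        using j' by (intro min_conv_x_val_1_ge) auto
      then have "int j + G t \<le> x_val \<alpha> 1 j"
        using t(1) j'(1) by (simp add: G_def)
      moreover have "1 \<le> t \<longleftrightarrow> p1 \<le> j" "2 \<le> t \<longleftrightarrow> p2 \<le> j" "3 \<le> t \<longleftrightarrow> p3 \<le> j"
        using iff[OF staircase_seq_split(1)] iff[OF staircase_seq_split(2)]
          iff[OF staircase_seq_split(3)[of 0]] p
        by (auto simp: count_list_replicate)
      ultimately show thesis using that[of t] j j'(1) by auto
    qed
    have "z * (j + 1) \<le> G t + G (c - 1)"
    proof -
      consider "t = 0" "j + 1 \<le> p1" | "t = 1" "j + 1 \<le> p2" | "t = 2" "j + 1 \<le> p3"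
        using t(2,3,4) j p by linarith
      then show ?thesis
      proof cases
        case 1
        then have "z * (j + 1) \<le> z * p1" using z(1) by (intro mult_left_mono) auto
        with 1 z G_0_ge show ?thesis by simp
      next
        case 2
        then have "z * (j + 1) \<le> z * p2" using z(1) by (intro mult_left_mono) auto
        with 2 z G_1_ge show ?thesis by simp
      next
        case 3
        then have "z * (j + 1) \<le> z * p3" using z(1) by (intro mult_left_mono) auto
        with 3 z G_2_ge show ?thesis by simp
      qed
    qed
    moreover have "beta c \<alpha> = 1 + G (c - 1)" by (simp add: beta_def G_def)
    moreover have "real_of_int (int j + G t) \<le> x_val \<alpha> 1 j" using t(1) by (simp only: of_int_le_iff)
    ultimately have "(1 + z) * real (j + 1) \<le> real_of_int (x_val \<alpha> 1 j + beta c \<alpha>)"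
      by (simp add: algebra_simps)
    then show ?thesis by (simp add: pos_le_divide_eq)
  qed
  then show ?thesis
    unfolding delta_seq_def by (subst Min_ge_iff) auto
qed

end

section \<open>Rounding, passage to the limit, and the three values\<close>

lemma delta_eqI:
  fixes z :: real
  assumes c: "4 \<le> c" and z: "2 \<le> z"
    and upper: "\<And>l \<alpha>. 1 \<le> l \<Longrightarrow> \<alpha> \<in> W l c \<Longrightarrow> delta_seq l c \<alpha> \<le> 1 + z"
    and lower: "\<And>p1 p2 p3. 1 \<le> p1 \<Longrightarrow> p1 \<le> p2 \<Longrightarrow> p2 \<le> p3 \<Longrightarrow>
      (1 + 1 / z) * p1 - 1 \<le> real p2 \<Longrightarrow> (1 + 2 / z) * p1 - 1 \<le> real p3 \<Longrightarrow>
      z * p1 - 2 \<le> min_conv (x_val (staircase_seq p1 p2 p3 c) 2) (c - 1)"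
  shows "delta c = ereal (1 + z)"
proof -
  define S where "S = {ereal (delta_seq l c \<alpha>) | l \<alpha>. l \<ge> 1 \<and> \<alpha> \<in> W l c \<and> \<alpha> ! (l + c - 2 - 1) = 2}"
  have le: "Sup S \<le> ereal (1 + z)"
    using upper by (intro Sup_least) (auto simp: S_def)
  have approx: "ereal (1 + (z - 2 / (2 + real n))) \<le> Sup S" for n
  proof -
    \<comment> \<open>Without rounding, and with \<open>G (c - 1) = z * p1\<close>, these ratios
      turn all three conditions of \<open>delta_seq_ge\<close> into equalities. Starting at
      \<open>2\<close> keeps \<open>2 / p1\<close> at most \<open>1\<close>, so that
      \<open>w\<close> below is nonnegative.\<close>
    define p1 where "p1 = 2 + n"
    define p2 where "p2 = nat \<lfloor>(1 + 1 / z) * p1\<rfloor>"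
    define p3 where "p3 = nat \<lfloor>(1 + 2 / z) * p1\<rfloor>"
    have real_nat_floor: "real (nat \<lfloor>y\<rfloor>) \<le> y \<and> y - 1 \<le> real (nat \<lfloor>y\<rfloor>)" if "0 \<le> y" for y :: real
      using that by linarith
    have p2: "real p2 \<le> (1 + 1 / z) * p1" "(1 + 1 / z) * p1 - 1 \<le> real p2"
      and p3: "real p3 \<le> (1 + 2 / z) * p1" "(1 + 2 / z) * p1 - 1 \<le> real p3"
      unfolding p2_def p3_def using z real_nat_floor by simp_all
    have "real p1 \<le> (1 + 1 / z) * p1"
      using z by (simp add: field_simps)
    then have "p1 \<le> p2" by (simp add: p2_def le_nat_floor)
    have "(1 + 1 / z) * p1 \<le> (1 + 2 / z) * p1"
      using z by (intro mult_right_mono add_left_mono divide_right_mono) auto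
    then have "p2 \<le> p3" unfolding p2_def p3_def by (intro nat_mono floor_mono)
    have p: "1 \<le> p1" "p1 \<le> p2" "p2 \<le> p3" 
      using \<open>p1 \<le> p2\<close> \<open>p2 \<le> p3\<close> by (auto simp: p1_def)
    define \<alpha> where "\<alpha> = staircase_seq p1 p2 p3 c"
    define G where "G = min_conv (x_val \<alpha> 2) (c - 1)"
    have G: "z * p1 - 2 \<le> G"
      unfolding G_def \<alpha>_def by (rule lower[OF p p2(2) p3(2)])
    \<comment> \<open>Rounding \<open>p2\<close> and \<open>p3\<close> down may cost up to
      \<open>2\<close> in the offset, which is the slack in \<open>lower\<close>. Lowering the slope
      by \<open>2 / p1\<close> gains at least \<open>2\<close> at every \<open>p' \<ge> p1\<close>
      and makes up for it.\<close>
    define w where "w = z - 2 / real p1"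
    have "2 / real p1 \<le> 1" by (simp add: p1_def)
    with z have w: "0 \<le> w" by (simp add: w_def)
    have w1: "w * p1 = z * p1 - 2"
      using p by (simp add: w_def field_simps)
    have w_mult: "w * p' \<le> z * y - 2" if "p1 \<le> p'" "real p' \<le> y" for p' y
    proof -
      have "z * real p' \<le> z * y" using that z by (intro mult_left_mono) auto
      moreover have "2 \<le> 2 / real p1 * real p'" using that(1) p(1) by (simp add: field_simps)
      ultimately show ?thesis by (simp add: w_def algebra_simps)
    qed
    have "z * ((1 + 1 / z) * p1) = z * p1 + p1" "z * ((1 + 2 / z) * p1) = z * p1 + 2 * p1"
      using z by (simp_all add: field_simps)
    with w_mult[OF p(2) p2(1)] w_mult[of p3, OF _ p3(1)] p w1 G
    have "1 + w \<le> delta_seq p3 c \<alpha>"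
      unfolding \<alpha>_def G_def by (intro delta_seq_ge[OF p c w]) auto
    moreover have "ereal (delta_seq p3 c \<alpha>) \<in> S"
      unfolding S_def \<alpha>_def using staircase_seq_mem[OF p c] staircase_seq_last[OF p c] p by force
    ultimately show ?thesis
      by (intro Sup_upper2[of "ereal (delta_seq p3 c \<alpha>)"]) (auto simp: w_def p1_def)
  qed
  have "filterlim (\<lambda>n. 2 + real n) at_top sequentially"
    by (intro filterlim_tendsto_add_at_top[OF tendsto_const] filterlim_real_sequentially)
  then have "(\<lambda>n. 2 / (2 + real n)) \<longlonglongrightarrow> 0"
    by (intro tendsto_divide_0[OF tendsto_const] filterlim_at_top_imp_at_infinity)
  then have "(\<lambda>n. ereal (1 + (z - 2 / (2 + real n)))) \<longlonglongrightarrow> ereal (1 + (z - 0))"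
    by (intro tendsto_intros)
  then have "ereal (1 + (z - 0)) \<le> Sup S"
    by (rule LIMSEQ_le_const2) (use approx in blast)
  with le have "Sup S = ereal (1 + z)"
    by (simp only: diff_zero order.antisym)
  then show ?thesis
    using c by (simp add: delta_def S_def)
qed

theorem theorem6:
  "delta 4 = ereal (1/2 * (sqrt 13 + 5)) \<and>
   delta 5 = ereal (1/2 * (sqrt 24 + 6)) \<and>
   delta 6 = ereal (1/2 * (sqrt 37 + 7))"
proof (intro conjI)
  define z :: real where "z = (sqrt 13 + 3) / 2"
  have "1 \<le> sqrt 13" by simp
  then have z: "2 \<le> z" by (simp add: z_def)
  \<comment> \<open>This is the condition \<open>z * p1 = 2 * p1 + p2\<close> for
    \<open>p2 = (1 + 1 / z) * p1\<close>, where the right side is the bound of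
    \<open>G_3_ge\<close>.\<close>
  have z_eq: "z = 3 + 1 / z"
  proof -
    have "z * z = 3 * z + 1" by (simp add: z_def field_simps)
    with z show ?thesis by (simp add: field_simps)
  qed
  have "delta 4 = ereal (1 + z)"
  proof (rule delta_eqI[OF _ z])
    show "delta_seq l 4 \<alpha> \<le> 1 + z" if "1 \<le> l" "\<alpha> \<in> W l 4" for l \<alpha>
      using delta_seq_upper(1)[OF that(2,1)] by (simp add: z_def field_simps)
    fix p1 p2 p3 :: nat
    assume p: "1 \<le> p1" "p1 \<le> p2" "p2 \<le> p3" and p2: "(1 + 1 / z) * p1 - 1 \<le> real p2"
    have "z * p1 = (3 + 1 / z) * p1" using z_eq by simp
    then show "z * p1 - 2 \<le> min_conv (x_val (staircase_seq p1 p2 p3 4) 2) (4 - 1)"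
      using G_3_ge[OF p, of 4] p2 by (simp add: algebra_simps)
  qed simp
  then show "delta 4 = ereal (1/2 * (sqrt 13 + 5))"
    by (simp add: z_def field_simps)
next
  define z :: real where "z = (sqrt 24 + 4) / 2"
  have z: "2 \<le> z" by (simp add: z_def)
  \<comment> \<open>At the limiting ratios both terms \<open>3 * p1 + p3\<close> and
    \<open>2 * p1 + 2 * p2\<close> of \<open>G_4_ge\<close> equal
    \<open>(4 + 2 / z) * p1\<close>.\<close>
  have z_eq: "z = 4 + 2 / z"
  proof -
    have "z * z = 4 * z + 2" by (simp add: z_def field_simps)
    with z show ?thesis by (simp add: field_simps)
  qed
  have "delta 5 = ereal (1 + z)"
  proof (rule delta_eqI[OF _ z])
    show "delta_seq l 5 \<alpha> \<le> 1 + z" if "1 \<le> l" "\<alpha> \<in> W l 5" for l \<alpha>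
      using delta_seq_upper(2)[OF that(2,1)] by (simp add: z_def field_simps)
    fix p1 p2 p3 :: nat
    assume p: "1 \<le> p1" "p1 \<le> p2" "p2 \<le> p3" and p2: "(1 + 1 / z) * p1 - 1 \<le> real p2"
      and p3: "(1 + 2 / z) * p1 - 1 \<le> real p3"
    define q where "q = real p1 / z"
    have "(1 + 1 / z) * p1 = p1 + q" "(1 + 2 / z) * p1 = p1 + 2 * q" "(4 + 2 / z) * p1 = 4 * p1 + 2 * q"
      by (simp_all add: q_def algebra_simps)
    moreover have "z * p1 = (4 + 2 / z) * p1" using z_eq by simp
    ultimately have "z * p1 - 2 \<le> real (3 * p1 + p3)" "z * p1 - 2 \<le> real (2 * p1 + 2 * p2)"
      using p2 p3 by simp_all
    then show "z * p1 - 2 \<le> min_conv (x_val (staircase_seq p1 p2 p3 5) 2) (5 - 1)"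
      using G_4_ge[OF p, of 5] by (simp add: min_def split: if_splits)
  qed simp
  then show "delta 5 = ereal (1/2 * (sqrt 24 + 6))"
    by (simp add: z_def field_simps)
next
  define z :: real where "z = (sqrt 37 + 5) / 2"
  have z: "2 \<le> z" by (simp add: z_def)
  \<comment> \<open>At the limiting ratios the bound \<open>3 * p1 + p2 + p3\<close> of
    \<open>G_5_ge\<close> equals \<open>(5 + 3 / z) * p1\<close>.\<close>
  have z_eq: "z = 5 + 3 / z"
  proof -
    have "z * z = 5 * z + 3" by (simp add: z_def field_simps)
    with z show ?thesis by (simp add: field_simps)
  qed
  have "delta 6 = ereal (1 + z)"
  proof (rule delta_eqI[OF _ z])
    show "delta_seq l 6 \<alpha> \<le> 1 + z" if "1 \<le> l" "\<alpha> \<in> W l 6" for l \<alpha>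
      using delta_seq_upper(3)[OF that(2,1)] by (simp add: z_def field_simps)
    fix p1 p2 p3 :: nat
    assume p: "1 \<le> p1" "p1 \<le> p2" "p2 \<le> p3" and p2: "(1 + 1 / z) * p1 - 1 \<le> real p2"
      and p3: "(1 + 2 / z) * p1 - 1 \<le> real p3"
    define q where "q = real p1 / z"
    have "(1 + 1 / z) * p1 = p1 + q" "(1 + 2 / z) * p1 = p1 + 2 * q" "(5 + 3 / z) * p1 = 5 * p1 + 3 * q"
      by (simp_all add: q_def algebra_simps)
    moreover have "z * p1 = (5 + 3 / z) * p1" using z_eq by simp
    ultimately have "z * p1 - 2 \<le> real (3 * p1 + p2 + p3)"
      using p2 p3 by simp
    then show "z * p1 - 2 \<le> min_conv (x_val (staircase_seq p1 p2 p3 6) 2) (6 - 1)"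
      using G_5_ge[OF p, of 6] by simp
  qed simp
  then show "delta 6 = ereal (1/2 * (sqrt 37 + 7))"
    by (simp add: z_def field_simps)
qed

end
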